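(* Let $\phi:\mathcal{H}\to\mathbb{C}$ be a nonzero Lie algebra homomorphism, let $\xi\in\mathbb{C}$, let $w$ be the cyclic quasi-Whittaker vector of $M_\phi$, and let $\bar w\in L_{\phi,\xi}$ be its image. If $w'\in L_{\phi,\xi}$ is a quasi-Whittaker vector of type $\phi$, then $w'=c\bar w$ for some $c\in\mathbb{C}$.
   Context: The Schrödinger algebra $\mathfrak{S}$ is the complex Lie algebra with basis $e,h,f,p,q,z$ and brackets $[h,e]=2e$, $[h,f]=-2f$, $[e,f]=h$, $[h,p]=p$, $[h,q]=-q$, $[p,q]=z$, $[e,q]=p$, $[p,f]=-q$, $[f,q]=0$, $[e,p]=0$, $[z,\mathfrak{S}]=0$. Its Heisenberg subalgebra is $\mathcal{H}=\mathrm{span}_{\mathbb{C}}\{p,q,z\}$. For a Lie algebra homomorphism $\phi:\mathcal{H}\to\mathbb{C}$ (so $\phi(z)=0$), a nonzero vector $v$ of an $\mathfrak{S}$-module is a quasi-Whittaker vector of type $\phi$ if $xv=\phi(x)v$ for all $x\in\mathcal{H}$. For $\phi\neq 0$, the universal quasi-Whittaker module of type $\phi$ is $M_\phi=\mathcal{U}(\mathfrak{S})\otimes_{\mathcal{U}(\mathcal{H})}\mathbb{C}_\phi$, where $\mathbb{C}_\phi=\mathbb{C}w$ is the one-dimensional $\mathcal{H}$-module with $xw=\phi(x)w$ for $x\in\mathcal{H}$; write $w$ also for its cyclic vector $1\otimes w$. Put $C=\phi(p)^2f-\phi(q)^2e-\phi(p)\phi(q)h\in\mathcal{U}(\mathfrak{S})$.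 For $\xi\in\mathbb{C}$ put $W_{\phi,\xi}=\mathcal{U}(\mathfrak{S})(C-\xi)w\subseteq M_\phi$ and $L_{\phi,\xi}=M_\phi/W_{\phi,\xi}$; the bar denotes the canonical projection $M_\phi\to L_{\phi,\xi}$. *)

theory Defs
  imports Complex_Main "HOL-Library.Poly_Mapping" "HOL-Algebra.AbelCoset" "HOL-Algebra.Module"
begin

section \<open>Complex Lie algebras and associative algebras\<close>

class complex_vector = ab_group_add +
  fixes scaleC :: "complex \<Rightarrow> 'a \<Rightarrow> 'a"  (infixr \<open>*\<^sub>C\<close> 75)
  assumes scaleC_add_right: "c *\<^sub>C (x + y) = c *\<^sub>C x + c *\<^sub>C y"
    and scaleC_add_left: "(c + d) *\<^sub>C x = c *\<^sub>C x + d *\<^sub>C x"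
    and scaleC_scaleC: "c *\<^sub>C (d *\<^sub>C x) = (c * d) *\<^sub>C x"
    and scaleC_one: "1 *\<^sub>C x = x"

global_interpretation cv: vector_space "scaleC :: complex \<Rightarrow> 'a \<Rightarrow> 'a::complex_vector"
  by (rule vector_space.intro)
    (rule scaleC_add_right scaleC_add_left scaleC_scaleC scaleC_one)+

class complex_lie_algebra = complex_vector +
  fixes lie_bracket :: "'a \<Rightarrow> 'a \<Rightarrow> 'a"
  assumes lie_bracket_add_left: "lie_bracket (x + y) u = lie_bracket x u + lie_bracket y u"
    and lie_bracket_add_right: "lie_bracket u (x + y) = lie_bracket u x + lie_bracket u y"
    and lie_bracket_scaleC_left: "lie_bracket (c *\<^sub>C x) y = c *\<^sub>C lie_bracket x y"
    and lie_bracket_scaleC_right: "lie_bracket x (c *\<^sub>C y) = c *\<^sub>C lie_bracket x y"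
    and lie_bracket_self: "lie_bracket x x = 0"
    and lie_bracket_jacobi:
      "lie_bracket x (lie_bracket y u) + lie_bracket y (lie_bracket u x)
        + lie_bracket u (lie_bracket x y) = 0"

class complex_algebra_1 = ring_1 + complex_vector +
  assumes mult_scaleC_left: "(c *\<^sub>C x) * y = c *\<^sub>C (x * y)"
    and mult_scaleC_right: "x * (c *\<^sub>C y) = c *\<^sub>C (x * y)"

text \<open>As a Lie algebra, \<open>complex\<close> is one-dimensional and hence abelian.\<close>

instantiation complex :: "{complex_lie_algebra, complex_algebra_1}"
begin

definition scaleC_complex :: "complex \<Rightarrow> complex \<Rightarrow> complex"
  where "scaleC_complex = (*)"

definition lie_bracket_complex :: "complex \<Rightarrow> complex \<Rightarrow> complex"
  where "lie_bracket_complex x y = 0"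

instance
  by standard (simp_all add: scaleC_complex_def lie_bracket_complex_def algebra_simps)

end

definition lie_algebra_hom :: "('a::complex_lie_algebra \<Rightarrow> 'b::complex_lie_algebra) \<Rightarrow> bool"
  where "lie_algebra_hom f \<longleftrightarrow>
    (\<forall>x y. f (x + y) = f x + f y) \<and>
    (\<forall>c x. f (c *\<^sub>C x) = c *\<^sub>C f x) \<and>
    (\<forall>x y. f (lie_bracket x y) = lie_bracket (f x) (f y))"


section \<open>The Schroedinger algebra and its Heisenberg subalgebra\<close>

text \<open>Coordinates with respect to the basis \<open>e, h, f, p, q, z\<close>.\<close>

datatype schroedinger =
  Schr (ce: complex) (ch: complex) (cf: complex) (cp: complex) (cq: complex) (cz: complex)

instantiation schroedinger :: complex_lie_algebra
begin

definition zero_schroedinger :: schroedinger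
  where "0 = Schr 0 0 0 0 0 0"

definition plus_schroedinger :: "schroedinger \<Rightarrow> schroedinger \<Rightarrow> schroedinger"
  where "x + y = Schr (ce x + ce y) (ch x + ch y) (cf x + cf y)
                      (cp x + cp y) (cq x + cq y) (cz x + cz y)"

definition uminus_schroedinger :: "schroedinger \<Rightarrow> schroedinger"
  where "- x = Schr (- ce x) (- ch x) (- cf x) (- cp x) (- cq x) (- cz x)"

definition minus_schroedinger :: "schroedinger \<Rightarrow> schroedinger \<Rightarrow> schroedinger"
  where "x - y = Schr (ce x - ce y) (ch x - ch y) (cf x - cf y)
                      (cp x - cp y) (cq x - cq y) (cz x - cz y)"

definition scaleC_schroedinger :: "complex \<Rightarrow> schroedinger \<Rightarrow> schroedinger"
  where "c *\<^sub>C x = Schr (c * ce x) (c * ch x) (c * cf x) (c * cp x) (c * cq x) (c * cz x)"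

text \<open>The bilinear alternating extension of the bracket table, which is recovered in
  \<open>schroedinger_bracket_table\<close> below.\<close>

definition lie_bracket_schroedinger :: "schroedinger \<Rightarrow> schroedinger \<Rightarrow> schroedinger"
  where "lie_bracket x y = Schr
    (2 * (ch x * ce y - ce x * ch y))
    (ce x * cf y - cf x * ce y)
    (- 2 * (ch x * cf y - cf x * ch y))
    ((ch x * cp y - cp x * ch y) + (ce x * cq y - cq x * ce y))
    (- (ch x * cq y - cq x * ch y) - (cp x * cf y - cf x * cp y))
    (cp x * cq y - cq x * cp y)"

instance
  by standard
    (simp_all add: zero_schroedinger_def plus_schroedinger_def uminus_schroedinger_def
      minus_schroedinger_def scaleC_schroedinger_def lie_bracket_schroedinger_def
      schroedinger.expand algebra_simps)

end

definition sch_e :: schroedinger where "sch_e = Schr 1 0 0 0 0 0"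
definition sch_h :: schroedinger where "sch_h = Schr 0 1 0 0 0 0"
definition sch_f :: schroedinger where "sch_f = Schr 0 0 1 0 0 0"
definition sch_p :: schroedinger where "sch_p = Schr 0 0 0 1 0 0"
definition sch_q :: schroedinger where "sch_q = Schr 0 0 0 0 1 0"
definition sch_z :: schroedinger where "sch_z = Schr 0 0 0 0 0 1"

lemmas schroedinger_defs =
  zero_schroedinger_def plus_schroedinger_def uminus_schroedinger_def
  minus_schroedinger_def scaleC_schroedinger_def lie_bracket_schroedinger_def
  sch_e_def sch_h_def sch_f_def sch_p_def sch_q_def sch_z_def

lemma schroedinger_bracket_table:
  "lie_bracket sch_h sch_e = 2 *\<^sub>C sch_e"
  "lie_bracket sch_h sch_f = - 2 *\<^sub>C sch_f"
  "lie_bracket sch_e sch_f = sch_h"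
  "lie_bracket sch_h sch_p = sch_p"
  "lie_bracket sch_h sch_q = - sch_q"
  "lie_bracket sch_p sch_q = sch_z"
  "lie_bracket sch_e sch_q = sch_p"
  "lie_bracket sch_p sch_f = - sch_q"
  "lie_bracket sch_f sch_q = 0"
  "lie_bracket sch_e sch_p = 0"
  "lie_bracket sch_z x = 0"
  by (simp_all add: schroedinger_defs)

lemma schroedinger_basis_expansion:
  "x = ce x *\<^sub>C sch_e + ch x *\<^sub>C sch_h + cf x *\<^sub>C sch_f
     + cp x *\<^sub>C sch_p + cq x *\<^sub>C sch_q + cz x *\<^sub>C sch_z"
  by (simp add: schroedinger_defs)

typedef heisenberg = "cv.span {sch_p, sch_q, sch_z}"
  by (rule exI[of _ 0]) (rule cv.span_zero)

setup_lifting type_definition_heisenberg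

lemma span_heisenberg_eq:
  "cv.span {sch_p, sch_q, sch_z} = {x. ce x = 0 \<and> ch x = 0 \<and> cf x = 0}"
proof (rule Set.set_eqI, rule iffI)
  fix x assume "x \<in> cv.span {sch_p, sch_q, sch_z}"
  then show "x \<in> {x. ce x = 0 \<and> ch x = 0 \<and> cf x = 0}"
    by (induction rule: cv.span_induct_alt) (auto simp: schroedinger_defs)
next
  fix x assume "x \<in> {x. ce x = 0 \<and> ch x = 0 \<and> cf x = 0}"
  then have x: "x = cp x *\<^sub>C sch_p + cq x *\<^sub>C sch_q + cz x *\<^sub>C sch_z"
    by (simp add: schroedinger_defs schroedinger.expand)
  show "x \<in> cv.span {sch_p, sch_q, sch_z}"
    by (subst x) (intro cv.span_add cv.span_scale cv.span_base; simp)
qed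

instantiation heisenberg :: complex_lie_algebra
begin

lift_definition zero_heisenberg :: heisenberg is 0 by (rule cv.span_zero)
lift_definition plus_heisenberg :: "heisenberg \<Rightarrow> heisenberg \<Rightarrow> heisenberg" is "(+)"
  by (rule cv.span_add)
lift_definition uminus_heisenberg :: "heisenberg \<Rightarrow> heisenberg" is uminus
  by (rule cv.span_neg)
lift_definition minus_heisenberg :: "heisenberg \<Rightarrow> heisenberg \<Rightarrow> heisenberg" is "(-)"
  by (rule cv.span_diff)
lift_definition scaleC_heisenberg :: "complex \<Rightarrow> heisenberg \<Rightarrow> heisenberg" is "(*\<^sub>C)"
  by (rule cv.span_scale)
lift_definition lie_bracket_heisenberg :: "heisenberg \<Rightarrow> heisenberg \<Rightarrow> heisenberg" is lie_bracket
  unfolding span_heisenberg_eq by (simp add: schroedinger_defs)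

instance
proof
  fix a b c :: heisenberg and k l :: complex
  show "a + b + c = a + (b + c)" by transfer (rule add.assoc)
  show "a + b = b + a" by transfer (rule add.commute)
  show "0 + a = a" by transfer (rule add_0_left)
  show "- a + a = 0" by transfer (rule left_minus)
  show "a - b = a + - b" by transfer (rule diff_conv_add_uminus)
  show "k *\<^sub>C (a + b) = k *\<^sub>C a + k *\<^sub>C b" by transfer (rule scaleC_add_right)
  show "(k + l) *\<^sub>C a = k *\<^sub>C a + l *\<^sub>C a" by transfer (rule scaleC_add_left)
  show "k *\<^sub>C (l *\<^sub>C a) = (k * l) *\<^sub>C a" by transfer (rule scaleC_scaleC)
  show "1 *\<^sub>C a = a" by transfer (rule scaleC_one)
  show "lie_bracket (a + b) c = lie_bracket a c + lie_bracket b c"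
    by transfer (rule lie_bracket_add_left)
  show "lie_bracket c (a + b) = lie_bracket c a + lie_bracket c b"
    by transfer (rule lie_bracket_add_right)
  show "lie_bracket (k *\<^sub>C a) b = k *\<^sub>C lie_bracket a b"
    by transfer (rule lie_bracket_scaleC_left)
  show "lie_bracket a (k *\<^sub>C b) = k *\<^sub>C lie_bracket a b"
    by transfer (rule lie_bracket_scaleC_right)
  show "lie_bracket a a = 0" by transfer (rule lie_bracket_self)
  show "lie_bracket a (lie_bracket b c) + lie_bracket b (lie_bracket c a)
      + lie_bracket c (lie_bracket a b) = 0"
    by transfer (rule lie_bracket_jacobi)
qed

end

lift_definition heis_p :: heisenberg is sch_p by (rule cv.span_base) simp
lift_definition heis_q :: heisenberg is sch_q by (rule cv.span_base) simp
lift_definition heis_z :: heisenberg is sch_z by (rule cv.span_base) simp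

lemma lie_algebra_hom_Rep_heisenberg: "lie_algebra_hom Rep_heisenberg"
  by (simp add: lie_algebra_hom_def plus_heisenberg.rep_eq scaleC_heisenberg.rep_eq
      lie_bracket_heisenberg.rep_eq)


section \<open>Universal enveloping algebras\<close>

text \<open>
  The universal enveloping algebra of a Lie algebra \<open>'g\<close> is the free associative unital complex
  algebra on the underlying set of \<open>'g\<close> (the monoid algebra of the words in \<open>'g\<close>) modulo the
  two-sided ideal forcing the canonical map from \<open>'g\<close> to be linear and to turn brackets into
  commutators; equivalently, the tensor algebra modulo \<open>x \<otimes> y - y \<otimes> x - [x, y]\<close>.
\<close>

datatype 'g word = Word (letters: "'g list")

instantiation word :: (type) monoid_add
begin

definition zero_word :: "'a word" where "0 = Word []"

definition plus_word :: "'a word \<Rightarrow> 'a word \<Rightarrow> 'a word"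
  where "v + w = Word (letters v @ letters w)"

instance
  by standard (simp_all add: zero_word_def plus_word_def)

end

type_synonym 'g free_algebra = "'g word \<Rightarrow>\<^sub>0 complex"

definition free_gen :: "'g \<Rightarrow> 'g free_algebra"
  where "free_gen x = Poly_Mapping.single (Word [x]) 1"

definition free_scale :: "complex \<Rightarrow> 'g free_algebra \<Rightarrow> 'g free_algebra"
  where "free_scale c a = Poly_Mapping.single 0 c * a"

inductive_set uea_ideal :: "'g::complex_lie_algebra free_algebra set" where
  zero: "0 \<in> uea_ideal"
| add: "a \<in> uea_ideal \<Longrightarrow> b \<in> uea_ideal \<Longrightarrow> a + b \<in> uea_ideal"
| mult_left: "a \<in> uea_ideal \<Longrightarrow> b * a \<in> uea_ideal"
| mult_right: "a \<in> uea_ideal \<Longrightarrow> a * b \<in> uea_ideal"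
| gen_add: "free_gen (x + y) - free_gen x - free_gen y \<in> uea_ideal"
| gen_scale: "free_gen (c *\<^sub>C x) - free_scale c (free_gen x) \<in> uea_ideal"
| gen_bracket:
    "free_gen x * free_gen y - free_gen y * free_gen x - free_gen (lie_bracket x y) \<in> uea_ideal"

definition free_eval :: "('g \<Rightarrow> 'a::complex_algebra_1) \<Rightarrow> 'g free_algebra \<Rightarrow> 'a"
  where "free_eval f a =
    (\<Sum>v\<in>Poly_Mapping.keys a. Poly_Mapping.lookup a v *\<^sub>C prod_list (map f (letters v)))"

lemma free_eval_superset:
  assumes "finite S" "Poly_Mapping.keys a \<subseteq> S"
  shows "free_eval f a =
    (\<Sum>v\<in>S. Poly_Mapping.lookup a v *\<^sub>C prod_list (map f (letters v)))"
  unfolding free_eval_def using assms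
  by (intro sum.mono_neutral_left) (auto simp: in_keys_iff)

lemma free_eval_0 [simp]: "free_eval f 0 = 0"
  by (simp add: free_eval_def)

lemma free_eval_add: "free_eval f (a + b) = free_eval f a + free_eval f b"
proof -
  let ?S = "Poly_Mapping.keys a \<union> Poly_Mapping.keys b"
  have "Poly_Mapping.keys (a + b) \<subseteq> ?S" by (rule keys_add)
  then show ?thesis
    by (simp add: free_eval_superset[of ?S] lookup_add scaleC_add_left sum.distrib)
qed

lemma free_eval_single:
  "free_eval f (Poly_Mapping.single v c) = c *\<^sub>C prod_list (map f (letters v))"
  by (subst free_eval_superset[of "{v}"]) auto

lemma free_algebra_induct [case_names zero add_single]:
  assumes "P 0" "\<And>a v c. P a \<Longrightarrow> P (a + Poly_Mapping.single v c)"
  shows "P (a :: 'g free_algebra)"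
proof -
  have *: "(\<Sum>v\<in>S. Poly_Mapping.single v (Poly_Mapping.lookup a v)) = a"
    if "finite S" "Poly_Mapping.keys a \<subseteq> S" for S
    using that
    by (intro poly_mapping_eqI)
      (auto simp: lookup_sum lookup_single when_def in_keys_iff sum.delta)
  have "P (\<Sum>v\<in>S. Poly_Mapping.single v (Poly_Mapping.lookup a v))" if "finite S" for S
    using that
  proof induction
    case (insert v S)
    then show ?case
      using assms(2) by (simp add: add.commute[of "Poly_Mapping.single v _"])
  qed (simp add: assms(1))
  then show ?thesis
    using *[of "Poly_Mapping.keys a"] by (metis finite_keys order_refl)
qed

lemma free_eval_mult: "free_eval f (a * b) = free_eval f a * free_eval f b"
proof -
  have 1: "free_eval f (Poly_Mapping.single v c * b)
      = free_eval f (Poly_Mapping.single v c) * free_eval f b" for v c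
    by (induction b rule: free_algebra_induct)
      (auto simp: distrib_left free_eval_add mult_single free_eval_single plus_word_def
        mult_scaleC_left mult_scaleC_right scaleC_scaleC)
  show ?thesis
    by (induction a rule: free_algebra_induct) (auto simp: distrib_right free_eval_add 1)
qed

lemma free_eval_uminus: "free_eval f (- a) = - free_eval f a"
  using free_eval_add[of f a "- a"] by (simp add: eq_neg_iff_add_eq_0 add.commute)

lemma free_eval_diff: "free_eval f (a - b) = free_eval f a - free_eval f b"
  using free_eval_add[of f a "- b"] by (simp add: free_eval_uminus)

lemma free_eval_free_gen [simp]: "free_eval f (free_gen x) = f x"
  by (simp add: free_gen_def free_eval_single scaleC_one)

lemma free_eval_free_scale: "free_eval f (free_scale c a) = c *\<^sub>C free_eval f a"
  by (simp add: free_scale_def free_eval_mult free_eval_single zero_word_def mult_scaleC_left)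

lemma free_eval_1 [simp]: "free_eval f 1 = 1"
  by (simp flip: single_one add: free_eval_single zero_word_def scaleC_one)

lemma free_eval_uea_ideal:
  assumes "\<And>x y. f (x + y) = f x + f y" "\<And>c x. f (c *\<^sub>C x) = c *\<^sub>C f x"
    and "\<And>x y. f (lie_bracket x y) = f x * f y - f y * f x"
    and "a \<in> uea_ideal"
  shows "free_eval f a = 0"
  using assms(4)
  by induction
    (simp_all add: free_eval_add free_eval_mult free_eval_diff free_eval_free_scale assms(1-3))

lemma uea_ideal_uminus: "a \<in> uea_ideal \<Longrightarrow> - a \<in> uea_ideal"
  using uea_ideal.mult_left[of a "- 1"] by simp

lemma uea_ideal_diff: "a \<in> uea_ideal \<Longrightarrow> b \<in> uea_ideal \<Longrightarrow> a - b \<in> uea_ideal"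
  using uea_ideal.add[of a "- b"] uea_ideal_uminus[of b] by simp

lemma one_notin_uea_ideal: "1 \<notin> uea_ideal"
proof
  assume "(1 :: 'g::complex_lie_algebra free_algebra) \<in> uea_ideal"
  then have "free_eval (\<lambda>_::'g. 0::complex) 1 = 0"
    by (rule free_eval_uea_ideal[rotated -1]) (simp_all add: scaleC_complex_def)
  then show False by simp
qed

definition uea_rel :: "'g::complex_lie_algebra free_algebra \<Rightarrow> 'g free_algebra \<Rightarrow> bool"
  where "uea_rel a b \<longleftrightarrow> a - b \<in> uea_ideal"

quotient_type (overloaded) 'g uea = "'g::complex_lie_algebra free_algebra" / uea_rel
proof (rule equivpI)
  show "reflp uea_rel"
    by (simp add: reflp_def uea_rel_def uea_ideal.zero)
  show "symp uea_rel"
    by (auto simp: symp_def uea_rel_def dest: uea_ideal_uminus)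
  show "transp uea_rel"
    by (auto simp: transp_def uea_rel_def dest: uea_ideal.add)
qed

lemma free_scale_commute: "Poly_Mapping.single 0 c * a = a * Poly_Mapping.single 0 c"
  for a :: "'g free_algebra"
  by (induction a rule: free_algebra_induct)
    (simp_all add: distrib_left distrib_right mult_single mult.commute)

lemma single_0_add: "Poly_Mapping.single 0 (c + d) = Poly_Mapping.single 0 c + Poly_Mapping.single 0 d"
  by (rule single_add)

instantiation uea :: (complex_lie_algebra) complex_algebra_1
begin

lift_definition zero_uea :: "'a uea" is 0 .
lift_definition one_uea :: "'a uea" is 1 .
lift_definition plus_uea :: "'a uea \<Rightarrow> 'a uea \<Rightarrow> 'a uea" is "(+)"
  unfolding uea_rel_def by (simp add: add_diff_add uea_ideal.add)
lift_definition uminus_uea :: "'a uea \<Rightarrow> 'a uea" is uminus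
  unfolding uea_rel_def by (metis minus_diff_minus uea_ideal_uminus)
lift_definition minus_uea :: "'a uea \<Rightarrow> 'a uea \<Rightarrow> 'a uea" is "(-)"
  unfolding uea_rel_def
proof -
  fix a a' b b' :: "'a free_algebra"
  assume "a - a' \<in> uea_ideal" "b - b' \<in> uea_ideal"
  then have "(a - a') - (b - b') \<in> uea_ideal"
    by (rule uea_ideal_diff)
  then show "a - b - (a' - b') \<in> uea_ideal"
    by (simp add: algebra_simps)
qed
lift_definition times_uea :: "'a uea \<Rightarrow> 'a uea \<Rightarrow> 'a uea" is "(*)"
  unfolding uea_rel_def
proof -
  fix a a' b b' :: "'a free_algebra"
  assume "a - a' \<in> uea_ideal" "b - b' \<in> uea_ideal"
  then have "(a - a') * b + a' * (b - b') \<in> uea_ideal"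
    by (intro uea_ideal.intros)
  then show "a * b - a' * b' \<in> uea_ideal"
    by (simp add: algebra_simps)
qed
lift_definition scaleC_uea :: "complex \<Rightarrow> 'a uea \<Rightarrow> 'a uea" is free_scale
  unfolding uea_rel_def free_scale_def
  by (simp flip: right_diff_distrib add: uea_ideal.mult_left)

instance
proof
  fix a b c :: "'a uea" and k l :: complex
  have eq: "uea_rel x y" if "x = y" for x y :: "'a free_algebra"
    using that by (simp add: uea_rel_def uea_ideal.zero)
  show "a + b + c = a + (b + c)" by transfer (rule eq, simp add: algebra_simps)
  show "a + b = b + a" by transfer (rule eq, simp add: algebra_simps)
  show "0 + a = a" by transfer (rule eq, simp)
  show "- a + a = 0" by transfer (rule eq, simp)
  show "a - b = a + - b" by transfer (rule eq, simp)
  show "a * b * c = a * (b * c)" by transfer (rule eq, simp add: mult.assoc)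
  show "(a + b) * c = a * c + b * c" by transfer (rule eq, simp add: distrib_right)
  show "a * (b + c) = a * b + a * c" by transfer (rule eq, simp add: distrib_left)
  show "1 * a = a" by transfer (rule eq, simp)
  show "a * 1 = a" by transfer (rule eq, simp)
  show "(0 :: 'a uea) \<noteq> 1"
    by transfer (use uea_ideal_uminus one_notin_uea_ideal in \<open>fastforce simp: uea_rel_def\<close>)
  show "k *\<^sub>C (a + b) = k *\<^sub>C a + k *\<^sub>C b"
    by transfer (rule eq, simp add: free_scale_def distrib_left)
  show "(k + l) *\<^sub>C a = k *\<^sub>C a + l *\<^sub>C a"
    by transfer (rule eq, simp add: free_scale_def single_0_add distrib_right)
  show "k *\<^sub>C (l *\<^sub>C a) = (k * l) *\<^sub>C a"
    by transfer (rule eq, simp add: free_scale_def mult_single flip: mult.assoc)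
  show "1 *\<^sub>C a = a"
    by transfer (rule eq, simp add: free_scale_def)
  show "(k *\<^sub>C a) * b = k *\<^sub>C (a * b)"
    by transfer (rule eq, simp add: free_scale_def mult.assoc)
  show "a * (k *\<^sub>C b) = k *\<^sub>C (a * b)"
    by transfer (rule eq, simp add: free_scale_def, metis free_scale_commute mult.assoc)
qed

end

lift_definition uea_incl :: "'g::complex_lie_algebra \<Rightarrow> 'g uea" is free_gen .

lemma uea_incl_add: "uea_incl (x + y) = uea_incl x + uea_incl y"
  by transfer (simp add: uea_rel_def flip: diff_diff_eq, rule uea_ideal.gen_add)

lemma uea_incl_scaleC: "uea_incl (c *\<^sub>C x) = c *\<^sub>C uea_incl x"
  by transfer (simp add: uea_rel_def uea_ideal.gen_scale)

lemma uea_incl_bracket: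
  "uea_incl (lie_bracket x y) = uea_incl x * uea_incl y - uea_incl y * uea_incl x"
proof -
  have "uea_incl x * uea_incl y - uea_incl y * uea_incl x = uea_incl (lie_bracket x y)"
    by transfer (simp add: uea_rel_def uea_ideal.gen_bracket)
  then show ?thesis ..
qed

text \<open>
  The universal property: a linear map \<open>f\<close> turning brackets into commutators extends to
  \<open>uea_lift f\<close>. For other \<open>f\<close> the value depends on the choice of representatives.
\<close>

definition uea_lift :: "('g::complex_lie_algebra \<Rightarrow> 'a::complex_algebra_1) \<Rightarrow> 'g uea \<Rightarrow> 'a"
  where "uea_lift f u = free_eval f (rep_uea u)"

definition uea_liftable :: "('g::complex_lie_algebra \<Rightarrow> 'a::complex_algebra_1) \<Rightarrow> bool"
  where "uea_liftable f \<longleftrightarrow>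
    (\<forall>x y. f (x + y) = f x + f y) \<and> (\<forall>c x. f (c *\<^sub>C x) = c *\<^sub>C f x) \<and>
    (\<forall>x y. f (lie_bracket x y) = f x * f y - f y * f x)"

lemma uea_lift_abs:
  assumes "uea_liftable f"
  shows "uea_lift f (abs_uea a) = free_eval f a"
proof -
  have "uea_rel (rep_uea (abs_uea a)) a"
    by (rule Quotient3_rep_abs[OF Quotient3_uea]) (simp add: uea_rel_def uea_ideal.zero)
  then have "free_eval f (rep_uea (abs_uea a) - a) = 0"
    using assms by (intro free_eval_uea_ideal) (auto simp: uea_rel_def uea_liftable_def)
  then show ?thesis
    by (simp add: uea_lift_def free_eval_diff)
qed

lemma uea_lift_hom:
  assumes "uea_liftable f"
  shows "uea_lift f (uea_incl x) = f x"
    and "uea_lift f 1 = 1"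
    and "uea_lift f (u + v) = uea_lift f u + uea_lift f v"
    and "uea_lift f (u * v) = uea_lift f u * uea_lift f v"
    and "uea_lift f (c *\<^sub>C u) = c *\<^sub>C uea_lift f u"
proof -
  note abs = uea_lift_abs[OF assms]
  show "uea_lift f (uea_incl x) = f x" "uea_lift f 1 = 1"
    by (simp_all add: uea_incl.abs_eq one_uea.abs_eq abs)
  obtain a b where uv: "u = abs_uea a" "v = abs_uea b"
    by (metis Quotient3_abs_rep[OF Quotient3_uea])
  show "uea_lift f (u + v) = uea_lift f u + uea_lift f v"
    "uea_lift f (u * v) = uea_lift f u * uea_lift f v"
    "uea_lift f (c *\<^sub>C u) = c *\<^sub>C uea_lift f u"
    by (simp_all add: uv plus_uea.abs_eq times_uea.abs_eq scaleC_uea.abs_eq abs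
        free_eval_add free_eval_mult free_eval_free_scale)
qed

definition uea_map ::
    "('g::complex_lie_algebra \<Rightarrow> 'h::complex_lie_algebra) \<Rightarrow> 'g uea \<Rightarrow> 'h uea"
  where "uea_map f = uea_lift (\<lambda>x. uea_incl (f x))"

lemma uea_liftable_map: "lie_algebra_hom f \<Longrightarrow> uea_liftable (\<lambda>x. uea_incl (f x))"
  by (simp add: lie_algebra_hom_def uea_liftable_def uea_incl_add uea_incl_scaleC uea_incl_bracket)

lemma uea_liftable_complex: "lie_algebra_hom f \<Longrightarrow> uea_liftable (f :: _ \<Rightarrow> complex)"
  by (simp add: lie_algebra_hom_def uea_liftable_def lie_bracket_complex_def)


section \<open>Left modules, quotients and induced modules\<close>

text \<open>
  Left modules over a possibly noncommutative ring given by a type are represented by the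
  record type \<open>module\<close>, whose fields \<open>mult\<close> and \<open>one\<close> are irrelevant and left undefined
  in the constructions below.
\<close>

locale left_module = abelian_group M
  for M :: "('r::ring_1, 'm, 'b) module_scheme" (structure) +
  assumes act_closed: "x \<in> carrier M \<Longrightarrow> u \<odot> x \<in> carrier M"
    and act_add_left: "x \<in> carrier M \<Longrightarrow> (u + v) \<odot> x = u \<odot> x \<oplus> v \<odot> x"
    and act_add_right: "x \<in> carrier M \<Longrightarrow> y \<in> carrier M \<Longrightarrow> u \<odot> (x \<oplus> y) = u \<odot> x \<oplus> u \<odot> y"
    and act_mult: "x \<in> carrier M \<Longrightarrow> (u * v) \<odot> x = u \<odot> (v \<odot> x)"
    and act_one: "x \<in> carrier M \<Longrightarrow> 1 \<odot> x = x"

definition quotient_module :: "('r, 'm, 'b) module_scheme \<Rightarrow> 'm set \<Rightarrow> ('r, 'm set) module"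
  where "quotient_module M N =
    \<lparr>carrier = a_rcosets\<^bsub>M\<^esub> N, mult = undefined, one = undefined,
     zero = N, add = set_add M,
     smult = (\<lambda>u X. \<Union>x\<in>X. N +>\<^bsub>M\<^esub> (u \<odot>\<^bsub>M\<^esub> x))\<rparr>"

definition submodule_of :: "('r, 'm, 'b) module_scheme \<Rightarrow> 'm set \<Rightarrow> bool"
  where "submodule_of M N \<longleftrightarrow>
    additive_subgroup N M \<and> (\<forall>u. \<forall>x\<in>N. u \<odot>\<^bsub>M\<^esub> x \<in> N)"

lemma (in abelian_group) abelian_subgroupI4: "additive_subgroup N G \<Longrightarrow> abelian_subgroup N G"
  by (rule abelian_subgroupI3[OF _ abelian_group_axioms])

lemma abelian_group_quotient:
  fixes M (structure)
  assumes "abelian_group M" "additive_subgroup N M"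
  shows "abelian_group (quotient_module M N)"
proof -
  interpret abelian_group M by fact
  interpret N: abelian_subgroup N M
    using assms(2) by (rule abelian_subgroupI4)
  let ?Q = "quotient_module M N"
  have car: "carrier ?Q = {N +> x | x. x \<in> carrier M}"
    by (auto simp: quotient_module_def A_RCOSETS_def')
  have add: "(N +> x) \<oplus>\<^bsub>?Q\<^esub> (N +> y) = N +> (x \<oplus> y)"
    if "x \<in> carrier M" "y \<in> carrier M" for x y
    using that by (simp add: quotient_module_def N.a_rcos_sum)
  have zero: "\<zero>\<^bsub>?Q\<^esub> = N +> \<zero>"
    using a_coset_add_zero[OF N.a_subset] by (simp add: quotient_module_def)
  show ?thesis
  proof (rule abelian_groupI)
    fix x assume "x \<in> carrier ?Q"
    then obtain a where a: "x = N +> a" "a \<in> carrier M" by (auto simp: car)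
    then have "N +> (\<ominus> a) \<in> carrier ?Q" "(N +> (\<ominus> a)) \<oplus>\<^bsub>?Q\<^esub> x = \<zero>\<^bsub>?Q\<^esub>"
      by (auto simp: car add zero l_neg)
    then show "\<exists>y\<in>carrier ?Q. y \<oplus>\<^bsub>?Q\<^esub> x = \<zero>\<^bsub>?Q\<^esub>" by blast
  next
    show "\<zero>\<^bsub>?Q\<^esub> \<in> carrier ?Q" unfolding zero car by blast
  next
    fix x y assume "x \<in> carrier ?Q" "y \<in> carrier ?Q"
    then obtain a b where ab: "x = N +> a" "a \<in> carrier M" "y = N +> b" "b \<in> carrier M"
      by (auto simp: car)
    then show "x \<oplus>\<^bsub>?Q\<^esub> y = y \<oplus>\<^bsub>?Q\<^esub> x" by (simp add: add a_comm)
    from ab have "x \<oplus>\<^bsub>?Q\<^esub> y = N +> (a \<oplus> b)" "a \<oplus> b \<in> carrier M" by (simp_all add: add)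
    then show "x \<oplus>\<^bsub>?Q\<^esub> y \<in> carrier ?Q" unfolding car by blast
  qed (unfold car, auto simp: add zero a_assoc)
qed

lemma (in left_module) quotient_act:
  assumes "submodule_of M N" "x \<in> carrier M"
  shows "u \<odot>\<^bsub>quotient_module M N\<^esub> (N +> x) = N +> (u \<odot> x)"
proof -
  from assms have N: "additive_subgroup N M" "\<And>u x. x \<in> N \<Longrightarrow> u \<odot> x \<in> N"
    by (auto simp: submodule_of_def)
  interpret N: abelian_subgroup N M
    using N(1) by (rule abelian_subgroupI4)
  have "N +> (u \<odot> y) = N +> (u \<odot> x)" if "y \<in> N +> x" for y
  proof -
    from that obtain n where n: "n \<in> N" "y = n \<oplus> x"
      by (auto simp: a_r_coset_def')
    then have "u \<odot> y = u \<odot> n \<oplus> u \<odot> x"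
      using assms(2) N.a_Hcarr by (simp add: act_add_right)
    then have "u \<odot> y \<in> N +> (u \<odot> x)"
      using N(2)[OF n(1)] by (auto simp: a_r_coset_def')
    then show ?thesis
      using N.a_repr_independence'[of "u \<odot> y" "u \<odot> x"] assms(2) act_closed by simp
  qed
  moreover have "x \<in> N +> x"
    using assms(2) by (rule N.a_rcos_self)
  ultimately have "(\<Union>y\<in>N +> x. N +> (u \<odot> y)) = N +> (u \<odot> x)"
    by blast
  then show ?thesis
    by (simp add: quotient_module_def)
qed

lemma (in left_module) left_module_quotient:
  assumes "submodule_of M N"
  shows "left_module (quotient_module M N)"
proof -
  interpret N: abelian_subgroup N M
    using assms by (intro abelian_subgroupI4) (simp add: submodule_of_def)
  let ?Q = "quotient_module M N"
  have ab: "abelian_group ?Q"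
    using abelian_group_axioms N.additive_subgroup_axioms by (rule abelian_group_quotient)
  have car: "carrier ?Q = {N +> x | x. x \<in> carrier M}"
    by (auto simp: quotient_module_def A_RCOSETS_def')
  have add: "(N +> x) \<oplus>\<^bsub>?Q\<^esub> (N +> y) = N +> (x \<oplus> y)" if "x \<in> carrier M" "y \<in> carrier M" for x y
    using that by (simp add: quotient_module_def N.a_rcos_sum)
  note act = quotient_act[OF assms]
  show ?thesis
  proof (intro left_module.intro ab left_module_axioms.intro)
    fix x u assume "x \<in> carrier ?Q"
    then show "u \<odot>\<^bsub>?Q\<^esub> x \<in> carrier ?Q"
      by (auto simp: car act intro: act_closed)
  qed (auto simp: car act add act_closed act_add_left act_add_right act_mult act_one)
qed

definition cyclic_submodule :: "('r, 'm, 'b) module_scheme \<Rightarrow> 'm \<Rightarrow> 'm set"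
  where "cyclic_submodule M v = {u \<odot>\<^bsub>M\<^esub> v | u. True}"

lemma (in left_module) submodule_of_cyclic:
  assumes v: "v \<in> carrier M"
  shows "submodule_of M (cyclic_submodule M v)"
proof -
  have zero: "0 \<odot> v = \<zero>"
    using act_add_left[OF v, of 0 0] act_closed[OF v, of 0] by simp
  have neg: "\<ominus> (u \<odot> v) = (- u) \<odot> v" for u
    using act_add_left[OF v, of "- u" u] act_closed[OF v]
    by (intro minus_equality) (simp_all add: zero)
  have "subgroup (cyclic_submodule M v) (add_monoid M)"
  proof (rule group.subgroupI[OF a_group])
    show "cyclic_submodule M v \<subseteq> carrier (add_monoid M)"
      using v by (auto simp: cyclic_submodule_def act_closed)
    show "cyclic_submodule M v \<noteq> {}"
      by (auto simp: cyclic_submodule_def)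
  next
    fix x assume "x \<in> cyclic_submodule M v"
    then show "inv\<^bsub>add_monoid M\<^esub> x \<in> cyclic_submodule M v"
      using neg by (auto simp: cyclic_submodule_def a_inv_def)
  next
    fix x y assume "x \<in> cyclic_submodule M v" "y \<in> cyclic_submodule M v"
    then obtain a b where "x = a \<odot> v" "y = b \<odot> v" by (auto simp: cyclic_submodule_def)
    then have "x \<oplus> y = (a + b) \<odot> v" using v by (simp add: act_add_left)
    then show "x \<otimes>\<^bsub>add_monoid M\<^esub> y \<in> cyclic_submodule M v"
      by (auto simp: cyclic_submodule_def)
  qed
  then have "additive_subgroup (cyclic_submodule M v) M"
    by (rule additive_subgroupI)
  moreover have "u \<odot> x \<in> cyclic_submodule M v" if "x \<in> cyclic_submodule M v" for u x
    using that v by (auto simp: cyclic_submodule_def simp flip: act_mult)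
  ultimately show ?thesis by (simp add: submodule_of_def)
qed

text \<open>
  For a ring homomorphism \<open>j: A \<rightarrow> R\<close> and a left \<open>A\<close>-module \<open>N\<close> with action \<open>act\<close>,
  the tensor product of \<open>R\<close> and \<open>N\<close> over \<open>A\<close> is the free abelian group on \<open>R \<times> N\<close> modulo
  the subgroup generated by the relations of biadditivity and \<open>A\<close>-balancedness; \<open>R\<close>
  acts by multiplication on the first factor.
\<close>

definition free_pairs :: "('r::ring_1, 'r \<times> 'n \<Rightarrow>\<^sub>0 int) module"
  where "free_pairs =
    \<lparr>carrier = UNIV, mult = undefined, one = undefined, zero = 0, add = (+),
     smult = (\<lambda>u. frag_extend (\<lambda>(r, n). frag_of (u * r, n)))\<rparr>"

inductive_set tensor_relations :: "('a \<Rightarrow> 'r::ring_1) \<Rightarrow> ('a \<Rightarrow> 'n \<Rightarrow> 'n::ab_group_add)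
    \<Rightarrow> ('r \<times> 'n \<Rightarrow>\<^sub>0 int) set"
  for j act where
  zero: "0 \<in> tensor_relations j act"
| diff: "x \<in> tensor_relations j act \<Longrightarrow> y \<in> tensor_relations j act
    \<Longrightarrow> x - y \<in> tensor_relations j act"
| add_left: "frag_of (r + s, n) - frag_of (r, n) - frag_of (s, n) \<in> tensor_relations j act"
| add_right: "frag_of (r, m + n) - frag_of (r, m) - frag_of (r, n) \<in> tensor_relations j act"
| balanced: "frag_of (r * j a, n) - frag_of (r, act a n) \<in> tensor_relations j act"

definition induced_module :: "('a \<Rightarrow> 'r::ring_1) \<Rightarrow> ('a \<Rightarrow> 'n \<Rightarrow> 'n::ab_group_add)
    \<Rightarrow> ('r, ('r \<times> 'n \<Rightarrow>\<^sub>0 int) set) module"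
  where "induced_module j act = quotient_module free_pairs (tensor_relations j act)"

definition pure_tensor :: "('a \<Rightarrow> 'r::ring_1) \<Rightarrow> ('a \<Rightarrow> 'n \<Rightarrow> 'n::ab_group_add)
    \<Rightarrow> 'r \<Rightarrow> 'n \<Rightarrow> ('r \<times> 'n \<Rightarrow>\<^sub>0 int) set"
  where "pure_tensor j act r n = tensor_relations j act +>\<^bsub>free_pairs\<^esub> frag_of (r, n)"


lemma abelian_group_free_pairs: "abelian_group free_pairs"
proof (rule abelian_groupI)
  fix x :: "'a \<times> 'b \<Rightarrow>\<^sub>0 int"
  show "\<exists>y\<in>carrier free_pairs. y \<oplus>\<^bsub>free_pairs\<^esub> x = \<zero>\<^bsub>free_pairs\<^esub>"
    by (rule bexI[of _ "- x"]) (simp_all add: free_pairs_def)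
qed (simp_all add: free_pairs_def algebra_simps)

lemma tensor_relations_act:
  assumes "x \<in> tensor_relations j act"
  shows "u \<odot>\<^bsub>free_pairs\<^esub> x \<in> tensor_relations j act"
  using assms
proof induction
  case (balanced r a n)
  show ?case
    using tensor_relations.balanced[of "u * r" j a n act]
    by (simp add: free_pairs_def frag_extend_diff mult.assoc)
qed (auto simp: free_pairs_def frag_extend_diff distrib_left intro: tensor_relations.intros)

lemma additive_subgroup_tensor_relations:
  fixes j :: "'a \<Rightarrow> 'r::ring_1" and act :: "'a \<Rightarrow> 'n \<Rightarrow> 'n::ab_group_add"
  shows "additive_subgroup (tensor_relations j act) free_pairs"
proof -
  interpret F: abelian_group "free_pairs :: ('r::ring_1, 'r \<times> 'n \<Rightarrow>\<^sub>0 int) module"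
    by (rule abelian_group_free_pairs)
  have neg: "\<ominus>\<^bsub>free_pairs\<^esub> x = - x" for x :: "'r \<times> 'n \<Rightarrow>\<^sub>0 int"
    by (rule F.minus_equality) (simp_all add: free_pairs_def)
  have uminus: "- x \<in> tensor_relations j act" if "x \<in> tensor_relations j act" for x
    using tensor_relations.diff[OF tensor_relations.zero that] by simp
  have plus: "x + y \<in> tensor_relations j act"
    if "x \<in> tensor_relations j act" "y \<in> tensor_relations j act" for x y
    using tensor_relations.diff[OF that(1) uminus[OF that(2)]] by simp
  have "subgroup (tensor_relations j act) (add_monoid free_pairs)"
    by (rule group.subgroupI[OF F.a_group])
      (use neg uminus plus tensor_relations.zero[of j act] in
        \<open>auto simp: a_inv_def free_pairs_def\<close>)
  then show ?thesis by (rule additive_subgroupI)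
qed

lemma induced_act:
  fixes j :: "'a \<Rightarrow> 'r::ring_1" and act :: "'a \<Rightarrow> 'n \<Rightarrow> 'n::ab_group_add"
  shows "u \<odot>\<^bsub>induced_module j act\<^esub> (tensor_relations j act +>\<^bsub>free_pairs\<^esub> x)
    = tensor_relations j act +>\<^bsub>free_pairs\<^esub> (u \<odot>\<^bsub>free_pairs\<^esub> x)"
proof -
  let ?N = "tensor_relations j act"
  interpret N: abelian_subgroup ?N free_pairs
    using additive_subgroup_tensor_relations abelian_group_free_pairs
    by (rule abelian_subgroupI3)
  have "?N +>\<^bsub>free_pairs\<^esub> (u \<odot>\<^bsub>free_pairs\<^esub> y) = ?N +>\<^bsub>free_pairs\<^esub> (u \<odot>\<^bsub>free_pairs\<^esub> x)"
    if "y \<in> ?N +>\<^bsub>free_pairs\<^esub> x" for y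
  proof -
    from that obtain n where n: "n \<in> ?N" "y = n + x"
      by (auto simp: a_r_coset_def' free_pairs_def)
    then have "u \<odot>\<^bsub>free_pairs\<^esub> y \<in> ?N +>\<^bsub>free_pairs\<^esub> (u \<odot>\<^bsub>free_pairs\<^esub> x)"
      using tensor_relations_act[OF n(1), of u]
      by (auto simp: a_r_coset_def' free_pairs_def frag_extend_add)
    then show ?thesis
      using N.a_repr_independence' by (metis UNIV_I free_pairs_def partial_object.select_convs(1))
  qed
  moreover have "x \<in> ?N +>\<^bsub>free_pairs\<^esub> x"
    by (rule N.a_rcos_self) (simp add: free_pairs_def)
  ultimately have "(\<Union>y\<in>?N +>\<^bsub>free_pairs\<^esub> x. ?N +>\<^bsub>free_pairs\<^esub> (u \<odot>\<^bsub>free_pairs\<^esub> y))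
      = ?N +>\<^bsub>free_pairs\<^esub> (u \<odot>\<^bsub>free_pairs\<^esub> x)"
    by blast
  then show ?thesis
    by (simp add: induced_module_def quotient_module_def)
qed

lemma left_module_induced:
  fixes j :: "'a \<Rightarrow> 'r::ring_1" and act :: "'a \<Rightarrow> 'n \<Rightarrow> 'n::ab_group_add"
  shows "left_module (induced_module j act)"
proof -
  let ?N = "tensor_relations j act" and ?Q = "induced_module j act"
  interpret N: abelian_subgroup ?N free_pairs
    using additive_subgroup_tensor_relations abelian_group_free_pairs
    by (rule abelian_subgroupI3)
  have car0: "carrier free_pairs = UNIV" and add0: "x \<oplus>\<^bsub>free_pairs\<^esub> y = x + y" for x y
    by (simp_all add: free_pairs_def)
  have ab: "abelian_group ?Q"
    unfolding induced_module_def
    using abelian_group_free_pairs additive_subgroup_tensor_relations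
    by (rule abelian_group_quotient)
  let ?c = "\<lambda>x. ?N +>\<^bsub>free_pairs\<^esub> x"
  have car: "carrier ?Q = range ?c"
    by (auto simp: quotient_module_def induced_module_def A_RCOSETS_def' car0)
  have add: "?c x \<oplus>\<^bsub>?Q\<^esub> ?c y = ?c (x + y)" for x y
    using N.a_rcos_sum[of x y] by (simp add: quotient_module_def induced_module_def car0 add0)
  have eqI: "?c x = ?c y" if "x - y \<in> ?N" for x y
  proof -
    have "x \<in> ?c y" using that by (force simp: a_r_coset_def' add0)
    then show ?thesis using N.a_repr_independence'[of x y] by (simp add: car0)
  qed
  have act_add: "u \<odot>\<^bsub>free_pairs\<^esub> (x - y) = u \<odot>\<^bsub>free_pairs\<^esub> x - u \<odot>\<^bsub>free_pairs\<^esub> y"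
    "u \<odot>\<^bsub>free_pairs\<^esub> (x + y) = u \<odot>\<^bsub>free_pairs\<^esub> x + u \<odot>\<^bsub>free_pairs\<^esub> y"
    for u x y by (simp_all add: free_pairs_def frag_extend_diff frag_extend_add)
  have act_frag: "u \<odot>\<^bsub>free_pairs\<^esub> frag_of (r, n) = frag_of (u * r, n)" for u r n
    by (simp add: free_pairs_def)
  have act0: "u \<odot>\<^bsub>free_pairs\<^esub> 0 = 0" for u by (simp add: free_pairs_def)
  have l: "(u + v) \<odot>\<^bsub>free_pairs\<^esub> x - (u \<odot>\<^bsub>free_pairs\<^esub> x + v \<odot>\<^bsub>free_pairs\<^esub> x) \<in> ?N" for u v x
  proof -
    have "Poly_Mapping.keys x \<subseteq> UNIV" by simp
    then show ?thesis
    proof (induction x rule: frag_induction)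
      case zero
      then show ?case by (simp add: act0 tensor_relations.zero)
    next
      case (one x)
      then show ?case
        using tensor_relations.add_left[of "u * fst x" "v * fst x" "snd x" j act]
        by (cases x) (simp add: act_frag distrib_right diff_diff_eq)
    next
      case (diff a b)
      from tensor_relations.diff[OF this] show ?case
        by (simp add: act_add algebra_simps)
    qed
  qed
  have m: "(u * v) \<odot>\<^bsub>free_pairs\<^esub> x = u \<odot>\<^bsub>free_pairs\<^esub> (v \<odot>\<^bsub>free_pairs\<^esub> x)"
    for u v and x :: "'r \<times> 'n \<Rightarrow>\<^sub>0 int"
  proof -
    have "Poly_Mapping.keys x \<subseteq> UNIV" by simp
    then show ?thesis
      by (induction x rule: frag_induction) (auto simp: act0 act_add act_frag mult.assoc)
  qed
  have o: "1 \<odot>\<^bsub>free_pairs\<^esub> x = x" for x :: "'r \<times> 'n \<Rightarrow>\<^sub>0 int"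
  proof -
    have "Poly_Mapping.keys x \<subseteq> UNIV" by simp
    then show ?thesis
      by (induction x rule: frag_induction) (auto simp: act0 act_add act_frag)
  qed
  show ?thesis
    by (intro left_module.intro ab left_module_axioms.intro)
      (auto simp: car induced_act add act_add m o eqI[OF l])
qed

section \<open>Quasi-Whittaker vectors and modules\<close>

text \<open>
  Modules over the Schroedinger algebra are left modules over its enveloping algebra: a Lie
  algebra element \<open>x\<close> acts as \<open>uea_incl x\<close> and a scalar \<open>c\<close> as \<open>c *\<^sub>C 1\<close>.
\<close>

definition quasi_whittaker ::
    "(schroedinger uea, 'm) module \<Rightarrow> (heisenberg \<Rightarrow> complex) \<Rightarrow> 'm \<Rightarrow> bool"
  where "quasi_whittaker V \<phi> v \<longleftrightarrow> v \<in> carrier V \<and> v \<noteq> \<zero>\<^bsub>V\<^esub> \<and>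
    (\<forall>x. uea_incl (Rep_heisenberg x) \<odot>\<^bsub>V\<^esub> v = (\<phi> x *\<^sub>C 1) \<odot>\<^bsub>V\<^esub> v)"

definition heis_incl :: "heisenberg uea \<Rightarrow> schroedinger uea"
  where "heis_incl = uea_map Rep_heisenberg"

text \<open>The action on the one-dimensional module \<open>\<complex>w\<close> attached to \<open>\<phi>\<close>, with \<open>w = 1\<close>.\<close>

definition heis_char_act :: "(heisenberg \<Rightarrow> complex) \<Rightarrow> heisenberg uea \<Rightarrow> complex \<Rightarrow> complex"
  where "heis_char_act \<phi> a c = uea_lift \<phi> a * c"

type_synonym qw_elem = "(schroedinger uea \<times> complex \<Rightarrow>\<^sub>0 int) set"

definition M_mod :: "(heisenberg \<Rightarrow> complex) \<Rightarrow> (schroedinger uea, qw_elem) module"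
  where "M_mod \<phi> = induced_module heis_incl (heis_char_act \<phi>)"

definition w_vec :: "(heisenberg \<Rightarrow> complex) \<Rightarrow> qw_elem"
  where "w_vec \<phi> = pure_tensor heis_incl (heis_char_act \<phi>) 1 1"

definition C_elem :: "(heisenberg \<Rightarrow> complex) \<Rightarrow> schroedinger uea"
  where "C_elem \<phi> = (\<phi> heis_p)\<^sup>2 *\<^sub>C uea_incl sch_f - (\<phi> heis_q)\<^sup>2 *\<^sub>C uea_incl sch_e
    - (\<phi> heis_p * \<phi> heis_q) *\<^sub>C uea_incl sch_h"

definition W_sub :: "(heisenberg \<Rightarrow> complex) \<Rightarrow> complex \<Rightarrow> qw_elem set"
  where "W_sub \<phi> \<xi> = cyclic_submodule (M_mod \<phi>) ((C_elem \<phi> - \<xi> *\<^sub>C 1) \<odot>\<^bsub>M_mod \<phi>\<^esub> w_vec \<phi>)"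

definition L_mod :: "(heisenberg \<Rightarrow> complex) \<Rightarrow> complex \<Rightarrow> (schroedinger uea, qw_elem set) module"
  where "L_mod \<phi> \<xi> = quotient_module (M_mod \<phi>) (W_sub \<phi> \<xi>)"

definition L_proj :: "(heisenberg \<Rightarrow> complex) \<Rightarrow> complex \<Rightarrow> qw_elem \<Rightarrow> qw_elem set"
  where "L_proj \<phi> \<xi> v = W_sub \<phi> \<xi> +>\<^bsub>M_mod \<phi>\<^esub> v"

lemma left_module_M_mod: "left_module (M_mod \<phi>)"
  unfolding M_mod_def by (rule left_module_induced)

lemma w_vec_in_carrier: "w_vec \<phi> \<in> carrier (M_mod \<phi>)"
  by (auto simp: w_vec_def pure_tensor_def M_mod_def induced_module_def quotient_module_def
      A_RCOSETS_def' free_pairs_def)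

lemma submodule_of_W_sub: "submodule_of (M_mod \<phi>) (W_sub \<phi> \<xi>)"
  unfolding W_sub_def
  by (intro left_module.submodule_of_cyclic left_module.act_closed left_module_M_mod
      w_vec_in_carrier)

lemma left_module_L_mod: "left_module (L_mod \<phi> \<xi>)"
  unfolding L_mod_def
  by (rule left_module.left_module_quotient[OF left_module_M_mod submodule_of_W_sub])

end

theory Submission
  imports Defs
begin

text \<open>
  Let \<open>a = \<phi> p\<close>, \<open>b = \<phi> q\<close>, and let \<open>J\<close> be the annihilator of \<open>w\<close> in \<open>L\<close>: a left ideal of the
  enveloping algebra \<open>U\<close> that contains \<open>p - a\<close>, \<open>q - b\<close>, \<open>z\<close> and \<open>C - \<xi>\<close>. As \<open>w\<close> generates \<open>L\<close>,
  it suffices to show that \<open>u \<in> \<complex> + J\<close> whenever \<open>(p - a) u\<close> and \<open>(q - b) u\<close> lie in \<open>J\<close>.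

  Heuristically, \<open>L\<close> consists of the derivatives of a delta function at the point \<open>(a, b)\<close> of a plane
  on which \<open>p\<close> and \<open>q\<close> are the coordinates and \<open>e\<close>, \<open>f\<close>, \<open>h\<close> are linear vector fields,
  corrected by functions that depend on \<open>\<xi>\<close>. At this point, which is not the origin, the vector
  fields span the two-dimensional tangent space, and their only linear relation there is \<open>C\<close>. Combinations \<open>X\<close>, \<open>Y\<close> of \<open>e\<close>, \<open>f\<close>, \<open>h\<close> can thus be
  chosen that play the parts of the partial derivatives, and \<open>D = X (p - a) + Y (q - b)\<close> is, up
  to sign and terms of lower order, the Euler operator that multiplies a derivative of order
  \<open>n\<close> by \<open>n\<close>. A vector killed by \<open>p - a\<close> and \<open>q - b\<close> is killed by \<open>D\<close>, so its order drops until
  it is \<open>0\<close>, which makes the vector a multiple of \<open>w\<close>.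

  The proof carries this out with the order filtration \<open>filt\<close> of \<open>U\<close> modulo \<open>J\<close>: \<open>filt_heis\<close> says
  that \<open>p - a\<close> and \<open>q - b\<close> lower the order, \<open>filt_cas\<close> that \<open>C\<close> does not raise it, and
  \<open>filt_euler\<close> is the eigenvalue property of \<open>D\<close>. Each step shows that some element lies in
  some level of the filtration, never that it lies outside of one.
\<close>

section \<open>Induction over an enveloping algebra\<close>

lemma uea_induct [case_names one add scale act]:
  fixes u :: "'g::complex_lie_algebra uea"
  assumes one: "P 1"
    and add: "\<And>u v. P u \<Longrightarrow> P v \<Longrightarrow> P (u + v)"
    and scale: "\<And>c u. P u \<Longrightarrow> P (c *\<^sub>C u)"
    and act: "\<And>x u. P u \<Longrightarrow> P (uea_incl x * u)"
  shows "P u"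
proof -
  have word: "P (abs_uea (Poly_Mapping.single (Word xs) c))" for xs :: "'g list" and c
  proof (induction xs)
    case Nil
    have "Poly_Mapping.single (Word []) c = free_scale c (1 :: 'g free_algebra)"
      by (simp add: free_scale_def zero_word_def)
    then show ?case
      using scale[OF one, of c] by (simp add: one_uea.abs_eq scaleC_uea.abs_eq)
  next
    case (Cons x xs)
    have "Poly_Mapping.single (Word (x # xs)) c = free_gen x * Poly_Mapping.single (Word xs) c"
      by (simp add: free_gen_def mult_single plus_word_def)
    then show ?case
      using act[OF Cons, of x] by (simp add: uea_incl.abs_eq times_uea.abs_eq)
  qed
  have "P (abs_uea a)" for a :: "'g free_algebra"
  proof (induction a rule: free_algebra_induct)
    case zero
    show ?case using scale[OF one, of 0] by (simp add: zero_uea_def)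
  next
    case (add_single a v c)
    then show ?case
      using assms(2)[OF add_single word[of "letters v" c]] by (simp add: plus_uea.abs_eq)
  qed
  then show ?thesis by (metis Quotient3_abs_rep[OF Quotient3_uea])
qed

lemma uea_incl_diff: "uea_incl (x - y) = uea_incl x - uea_incl y"
  using uea_incl_add[of "x - y" y] by simp

lemma uea_incl_commute:
  "uea_incl x * (uea_incl y * u) = uea_incl y * (uea_incl x * u) + uea_incl (lie_bracket x y) * u"
  by (simp add: uea_incl_bracket algebra_simps)


section \<open>Left ideals containing the quasi-Whittaker relations\<close>

definition heis_part :: "schroedinger set"
  where "heis_part = {x. ce x = 0 \<and> ch x = 0 \<and> cf x = 0}"

lemma lie_bracket_heis_part: "x \<in> heis_part \<Longrightarrow> lie_bracket x s \<in> heis_part"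
  by (simp add: heis_part_def lie_bracket_schroedinger_def)

definition cas :: "complex \<Rightarrow> complex \<Rightarrow> schroedinger"
  where "cas a b = a\<^sup>2 *\<^sub>C sch_f - b\<^sup>2 *\<^sub>C sch_e - (a * b) *\<^sub>C sch_h"

text \<open>
  The character \<open>p \<mapsto> a, q \<mapsto> b, z \<mapsto> 0\<close> of the Heisenberg subalgebra, extended by zero to
  \<open>e\<close>, \<open>h\<close>, \<open>f\<close> as a linear form.
\<close>

definition chi :: "complex \<Rightarrow> complex \<Rightarrow> schroedinger \<Rightarrow> complex"
  where "chi a b x = cp x * a + cq x * b"

text \<open>
  The vectors \<open>X\<close> and \<open>Y\<close> are dual to \<open>p\<close> and \<open>q\<close>: \<open>s \<mapsto> (\<chi> [s, p], \<chi> [s, q])\<close> maps \<open>e\<close>, \<open>h\<close>, \<open>f\<close>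
  to \<open>(0, a)\<close>, \<open>(a, -b)\<close>, \<open>(b, 0)\<close>. It is onto \<open>\<complex>\<^sup>2\<close> because \<open>(a, b) \<noteq> (0, 0)\<close>, its kernel on the
  span of \<open>e\<close>, \<open>h\<close>, \<open>f\<close> is the line through \<open>cas a b\<close>, and \<open>X\<close>, \<open>Y\<close> are preimages of
  \<open>(1, 0)\<close> and \<open>(0, 1)\<close>.
\<close>

lemma dual_vectors_exist:
  assumes "a \<noteq> 0 \<or> b \<noteq> 0"
  shows "\<exists>X Y g. \<forall>s. s - chi a b (lie_bracket s sch_p) *\<^sub>C X - chi a b (lie_bracket s sch_q) *\<^sub>C Y
    - g s *\<^sub>C cas a b \<in> heis_part"
proof (cases "a = 0")
  case False
  then show ?thesis
    by (intro exI[of _ "Schr (b / a\<^sup>2) (1 / a) 0 0 0 0"] exI[of _ "Schr (1 / a) 0 0 0 0 0"]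
        exI[of _ "\<lambda>s. cf s / a\<^sup>2"])
      (simp add: heis_part_def chi_def cas_def schroedinger_defs field_simps power2_eq_square)
next
  case True
  with assms have "b \<noteq> 0" by simp
  then show ?thesis
    by (intro exI[of _ "Schr 0 0 (1 / b) 0 0 0"] exI[of _ "Schr 0 (- 1 / b) 0 0 0 0"]
        exI[of _ "\<lambda>s. - ce s / b\<^sup>2"])
      (simp add: True heis_part_def chi_def cas_def schroedinger_defs field_simps power2_eq_square)
qed

locale whittaker_left_ideal =
  fixes J :: "schroedinger uea set" and a b \<xi> :: complex
  assumes J_zero: "0 \<in> J"
    and J_add: "u \<in> J \<Longrightarrow> v \<in> J \<Longrightarrow> u + v \<in> J"
    and J_mult: "v \<in> J \<Longrightarrow> u * v \<in> J"
    and J_p: "uea_incl sch_p - a *\<^sub>C 1 \<in> J"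
    and J_q: "uea_incl sch_q - b *\<^sub>C 1 \<in> J"
    and J_z: "uea_incl sch_z \<in> J"
    and J_cas: "uea_incl (cas a b) - \<xi> *\<^sub>C 1 \<in> J"
    and nontrivial: "a \<noteq> 0 \<or> b \<noteq> 0"
begin

lemma J_scale: "u \<in> J \<Longrightarrow> c *\<^sub>C u \<in> J"
  using J_mult[of u "c *\<^sub>C 1"] by (simp add: mult_scaleC_left)

lemma J_diff: "u \<in> J \<Longrightarrow> v \<in> J \<Longrightarrow> u - v \<in> J"
  using J_add[of u "- v"] J_mult[of v "- 1"] by simp

lemma J_heis:
  assumes "x \<in> heis_part"
  shows "uea_incl x - chi a b x *\<^sub>C 1 \<in> J"
proof -
  have "x = cp x *\<^sub>C sch_p + cq x *\<^sub>C sch_q + cz x *\<^sub>C sch_z"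
    using assms by (simp add: heis_part_def schroedinger_defs schroedinger.expand)
  then have "uea_incl x = cp x *\<^sub>C uea_incl sch_p + cq x *\<^sub>C uea_incl sch_q + cz x *\<^sub>C uea_incl sch_z"
    by (metis uea_incl_add uea_incl_scaleC)
  then have "uea_incl x - chi a b x *\<^sub>C 1 = cp x *\<^sub>C (uea_incl sch_p - a *\<^sub>C 1)
      + cq x *\<^sub>C (uea_incl sch_q - b *\<^sub>C 1) + cz x *\<^sub>C uea_incl sch_z"
    by (simp add: chi_def scaleC_add_left cv.scale_right_diff_distrib scaleC_scaleC)
  then show ?thesis
    by (simp add: J_add J_scale J_p J_q J_z)
qed

section \<open>The order filtration modulo the left ideal\<close>

text \<open>
  Level \<open>n\<close> consists of the elements of order less than \<open>n\<close> modulo \<open>J\<close>: with this shift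
  level \<open>0\<close> is \<open>J\<close> itself, so that it can receive the images of constants under lowering operators.
\<close>

inductive filt :: "nat \<Rightarrow> schroedinger uea \<Rightarrow> bool" where
  ideal: "u \<in> J \<Longrightarrow> filt n u"
| one: "filt (Suc n) 1"
| add: "filt n u \<Longrightarrow> filt n v \<Longrightarrow> filt n (u + v)"
| scale: "filt n u \<Longrightarrow> filt n (c *\<^sub>C u)"
| act: "filt n u \<Longrightarrow> filt (Suc n) (uea_incl x * u)"

lemma filt_diff: "filt n u \<Longrightarrow> filt n v \<Longrightarrow> filt n (u - v)"
  using filt.add[of n u "(- 1) *\<^sub>C v"] filt.scale[of n v "- 1"] by simp

lemma filt_0: "filt 0 u \<Longrightarrow> u \<in> J"
  by (induction "0::nat" u rule: filt.induct) (auto intro: J_add J_scale)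

lemma filt_Suc: "filt n u \<Longrightarrow> filt (Suc n) u"
  by (induction rule: filt.induct) (auto intro: filt.intros)

lemma filt_mono: "m \<le> n \<Longrightarrow> filt m u \<Longrightarrow> filt n u"
  by (induction rule: dec_induct) (auto intro: filt_Suc)

lemma filt_1: "filt 1 u \<Longrightarrow> \<exists>c. u - c *\<^sub>C 1 \<in> J"
proof (induction "1::nat" u rule: filt.induct)
  case (ideal u)
  then show ?case by (intro exI[of _ 0]) simp
next
  case one
  then show ?case by (intro exI[of _ 1]) (simp add: scaleC_one J_zero)
next
  case (add u v)
  then obtain c d where "u - c *\<^sub>C 1 \<in> J" "v - d *\<^sub>C 1 \<in> J" by blast
  from J_add[OF this] show ?case
    by (intro exI[of _ "c + d"]) (simp add: scaleC_add_left algebra_simps)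
next
  case (scale u c)
  then obtain d where "u - d *\<^sub>C 1 \<in> J" by blast
  from J_scale[OF this, of c] show ?case
    by (intro exI[of _ "c * d"]) (simp add: cv.scale_right_diff_distrib scaleC_scaleC)
next
  case (act n u x)
  then have "uea_incl x * u \<in> J" by (auto intro: J_mult filt_0)
  then show ?case by (intro exI[of _ 0]) simp
qed

lemma filt_exhausts: "\<exists>n. filt n u"
proof (induction u rule: uea_induct)
  case (add u v)
  then obtain m n where "filt m u" "filt n v" by blast
  then have "filt (max m n) u" "filt (max m n) v" 
    using filt_mono[of m "max m n" u] filt_mono[of n "max m n" v] by simp_all
  then show ?case by (auto intro: filt.add)
qed (auto intro: filt.intros)

text \<open>
  The commutator of \<open>x\<close> with a Lie algebra element is again in the Heisenberg part, which is an
  ideal, so moving \<open>x - \<chi> x\<close> to the right past one factor after another leaves terms with one factor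
  fewer. At the end, \<open>x - \<chi> x\<close> itself lies in \<open>J\<close>.
\<close>

lemma filt_heis:
  assumes "filt n u" "x \<in> heis_part"
  shows "filt (n - 1) (uea_incl x * u - chi a b x *\<^sub>C u)"
  using assms
proof (induction arbitrary: x rule: filt.induct)
  case (ideal u n)
  then show ?case by (intro filt.ideal J_diff J_mult J_scale)
next
  case (one n)
  then show ?case using J_heis by (simp add: filt.ideal)
next
  case (add n u v)
  from filt.add[OF add.IH(1)[OF add.prems] add.IH(2)[OF add.prems]]
  show ?case by (simp add: scaleC_add_right algebra_simps)
next
  case (scale n u c)
  from filt.scale[OF scale.IH[OF scale.prems], of c]
  show ?case
    by (simp add: cv.scale_right_diff_distrib mult_scaleC_right scaleC_scaleC mult.commute)
next
  case (act n u s)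
  show ?case
  proof (cases n)
    case 0
    with act.hyps have "u \<in> J" by (simp add: filt_0)
    then show ?thesis by (intro filt.ideal J_diff J_mult J_scale)
  next
    case (Suc m)
    let ?y = "lie_bracket x s"
    have "filt n (uea_incl s * (uea_incl x * u - chi a b x *\<^sub>C u))"
      using filt.act[OF act.IH[OF act.prems]] Suc by simp
    moreover have "filt n ((uea_incl ?y * u - chi a b ?y *\<^sub>C u) + chi a b ?y *\<^sub>C u)"
      using act.IH[OF lie_bracket_heis_part[OF act.prems], of s] act.hyps Suc
      by (intro filt.add filt.scale) (auto intro: filt_Suc)
    ultimately have "filt n (uea_incl s * (uea_incl x * u - chi a b x *\<^sub>C u)
        + ((uea_incl ?y * u - chi a b ?y *\<^sub>C u) + chi a b ?y *\<^sub>C u))"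
      by (rule filt.add)
    then show ?thesis
      by (simp add: uea_incl_commute[of x s] mult_scaleC_right algebra_simps)
  qed
qed

lemma filt_heis_mult:
  assumes "filt n u" "x \<in> heis_part"
  shows "filt n (uea_incl x * u)"
proof -
  have "filt n (uea_incl x * u - chi a b x *\<^sub>C u)"
    by (rule filt_mono[OF _ filt_heis[OF assms]]) simp
  from filt.add[OF this filt.scale[OF assms(1), of "chi a b x"]] show ?thesis by simp
qed

text \<open>
  As an element of the Lie algebra, \<open>C\<close> can only be expected to raise the order by one. But moving
  it past a factor merely replaces that factor by another Lie algebra element, and at the right end
  it becomes the scalar \<open>\<xi>\<close> modulo \<open>J\<close>.
\<close>

lemma filt_cas: "filt n u \<Longrightarrow> filt n (uea_incl (cas a b) * u)"
proof (induction rule: filt.induct)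
  case (one n)
  from filt.add[OF filt.ideal[OF J_cas] filt.scale[OF filt.one[of n], of \<xi>]]
  show ?case by simp
next
  case (act n u s)
  then show ?case
    by (subst uea_incl_commute) (intro filt.add filt.act)
qed (auto intro: filt.intros J_mult simp: distrib_left mult_scaleC_right)

section \<open>The Euler operator\<close>

text \<open>
  Moving \<open>D = X (p - a) + Y (q - b)\<close> past a Lie algebra element \<open>s\<close> produces
  \<open>-(\<chi> [s, p] X + \<chi> [s, q] Y)\<close> up to lower order, which is \<open>-s\<close> up to a multiple of \<open>C\<close> and a
  Heisenberg element, neither of which raises the order. So each factor contributes \<open>-1\<close> to the
  eigenvalue of \<open>D\<close>, and level \<open>Suc n\<close> is spanned by products of at most \<open>n\<close> factors.
\<close>

lemma filt_euler:
  assumes dual: "\<And>s. s - chi a b (lie_bracket s sch_p) *\<^sub>C X - chi a b (lie_bracket s sch_q) *\<^sub>C Y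
    - g s *\<^sub>C cas a b \<in> heis_part"
  defines "D \<equiv> uea_incl X * (uea_incl sch_p - a *\<^sub>C 1) + uea_incl Y * (uea_incl sch_q - b *\<^sub>C 1)"
  assumes "filt n u"
  shows "filt (n - 1) (D * u + of_nat (n - 1) *\<^sub>C u)"
  using assms(3)
proof (induction rule: filt.induct)
  case (ideal u n)
  then show ?case by (intro filt.ideal J_add J_mult J_scale)
next
  case (one n)
  have "filt n (of_nat n *\<^sub>C 1)"
    by (cases n) (auto intro: filt.intros J_zero)
  moreover have "D * 1 \<in> J" by (simp add: D_def J_add J_mult J_p J_q)
  ultimately show ?case by (simp add: filt.add filt.ideal)
next
  case (add n u v)
  from filt.add[OF add.IH] show ?case by (simp add: scaleC_add_right algebra_simps)
next
  case (scale n u c)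
  from filt.scale[OF scale.IH, of c] show ?case
    by (simp add: scaleC_add_right mult_scaleC_right scaleC_scaleC mult.commute)
next
  case (act n u s)
  show ?case
  proof (cases n)
    case 0
    with act.hyps have "u \<in> J" by (simp add: filt_0)
    then show ?thesis by (intro filt.ideal J_add J_mult J_scale)
  next
    case (Suc m)
    let ?P = "uea_incl sch_p * u - a *\<^sub>C u" and ?Q = "uea_incl sch_q * u - b *\<^sub>C u"
    let ?y = "lie_bracket sch_p s" and ?y' = "lie_bracket sch_q s"
    let ?r = "s - chi a b (lie_bracket s sch_p) *\<^sub>C X - chi a b (lie_bracket s sch_q) *\<^sub>C Y
      - g s *\<^sub>C cas a b"
    have pq: "sch_p \<in> heis_part" "sch_q \<in> heis_part"
      by (simp_all add: heis_part_def sch_p_def sch_q_def)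
    have chi_pq: "chi a b sch_p = a" "chi a b sch_q = b"
      by (simp_all add: chi_def sch_p_def sch_q_def)
    have chi_swap: "chi a b ?y = - chi a b (lie_bracket s sch_p)"
      "chi a b ?y' = - chi a b (lie_bracket s sch_q)"
      by (simp_all add: chi_def schroedinger_defs algebra_simps)
    have raise: "filt m v \<Longrightarrow> filt n (uea_incl x * v)" for x v
      using filt.act[of m v x] Suc by simp
    \<comment> \<open>All seven terms into which \<open>D s u + n s u\<close> is going to be decomposed have level \<open>n\<close>. The last two
      express \<open>s u - \<chi> [s, p] X u - \<chi> [s, q] Y u\<close>, in which \<open>s u\<close> is the surplus of \<open>n s u\<close>
      over \<open>m s u\<close>.\<close>
    have "filt n (uea_incl s * (D * u + of_nat m *\<^sub>C u))"
      using act.IH Suc by (intro raise) simp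
    moreover have "filt n (uea_incl (lie_bracket X s) * ?P)" "filt n (uea_incl (lie_bracket Y s) * ?Q)"
      using filt_heis[OF act.hyps pq(1)] filt_heis[OF act.hyps pq(2)] Suc chi_pq
      by (intro raise, simp)+
    moreover have "filt n (uea_incl X * (uea_incl ?y * u - chi a b ?y *\<^sub>C u))"
      "filt n (uea_incl Y * (uea_incl ?y' * u - chi a b ?y' *\<^sub>C u))"
      using filt_heis[OF act.hyps lie_bracket_heis_part[OF pq(1)], of s]
        filt_heis[OF act.hyps lie_bracket_heis_part[OF pq(2)], of s] Suc
      by (intro raise, simp)+
    moreover have "filt n (uea_incl ?r * u)" "filt n (g s *\<^sub>C (uea_incl (cas a b) * u))"
      using filt_heis_mult[OF act.hyps dual] filt.scale[OF filt_cas[OF act.hyps]] by auto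
    ultimately have sum: "filt n (uea_incl s * (D * u + of_nat m *\<^sub>C u)
        + uea_incl (lie_bracket X s) * ?P + uea_incl (lie_bracket Y s) * ?Q
        + uea_incl X * (uea_incl ?y * u - chi a b ?y *\<^sub>C u)
        + uea_incl Y * (uea_incl ?y' * u - chi a b ?y' *\<^sub>C u)
        + uea_incl ?r * u + g s *\<^sub>C (uea_incl (cas a b) * u))"
      by (intro filt.add)
    have move: "uea_incl x * ((uea_incl y - c *\<^sub>C 1) * (uea_incl s * u))
      = uea_incl s * (uea_incl x * (uea_incl y * u - c *\<^sub>C u))
        + uea_incl (lie_bracket x s) * (uea_incl y * u - c *\<^sub>C u)
        + uea_incl x * (uea_incl (lie_bracket y s) * u)" for x y c
      by (simp add: uea_incl_bracket algebra_simps mult_scaleC_left mult_scaleC_right)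
    have r: "uea_incl ?r * u = uea_incl s * u
      - chi a b (lie_bracket s sch_p) *\<^sub>C (uea_incl X * u)
      - chi a b (lie_bracket s sch_q) *\<^sub>C (uea_incl Y * u) - g s *\<^sub>C (uea_incl (cas a b) * u)"
      by (simp add: uea_incl_diff uea_incl_scaleC left_diff_distrib mult_scaleC_left)
    have Du: "D * u = uea_incl X * ?P + uea_incl Y * ?Q"
      by (simp add: D_def algebra_simps mult_scaleC_left mult_scaleC_right)
    have Dsu: "D * (uea_incl s * u)
      = uea_incl s * (uea_incl X * ?P) + uea_incl (lie_bracket X s) * ?P
        + uea_incl X * (uea_incl ?y * u)
        + (uea_incl s * (uea_incl Y * ?Q) + uea_incl (lie_bracket Y s) * ?Q
        + uea_incl Y * (uea_incl ?y' * u))"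
      by (simp only: D_def distrib_right mult.assoc move)
    have "D * (uea_incl s * u) + of_nat n *\<^sub>C (uea_incl s * u)
      = uea_incl s * (D * u + of_nat m *\<^sub>C u)
        + uea_incl (lie_bracket X s) * ?P + uea_incl (lie_bracket Y s) * ?Q
        + uea_incl X * (uea_incl ?y * u - chi a b ?y *\<^sub>C u)
        + uea_incl Y * (uea_incl ?y' * u - chi a b ?y' *\<^sub>C u)
        + uea_incl ?r * u + g s *\<^sub>C (uea_incl (cas a b) * u)"
      unfolding r Dsu Du chi_swap
      by (simp add: Suc scaleC_add_left scaleC_one distrib_left right_diff_distrib
          mult_scaleC_right)
    with sum show ?thesis by simp
  qed
qed

text \<open>
  On an element of level \<open>Suc (Suc n)\<close> that \<open>D\<close> maps into \<open>J\<close>, the eigenvalue property says that its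
  multiple by \<open>Suc n\<close> lies one level below. Division by \<open>Suc n\<close> lets the level drop to \<open>1\<close>,
  which is \<open>\<complex> + J\<close>.
\<close>

lemma whittaker_vector_scalar:
  assumes "(uea_incl sch_p - a *\<^sub>C 1) * u \<in> J" "(uea_incl sch_q - b *\<^sub>C 1) * u \<in> J"
  shows "\<exists>c. u - c *\<^sub>C 1 \<in> J"
proof -
  obtain X Y g where dual: "\<And>s. s - chi a b (lie_bracket s sch_p) *\<^sub>C X
      - chi a b (lie_bracket s sch_q) *\<^sub>C Y - g s *\<^sub>C cas a b \<in> heis_part"
    using dual_vectors_exist[OF nontrivial] by blast
  define D where
    "D = uea_incl X * (uea_incl sch_p - a *\<^sub>C 1) + uea_incl Y * (uea_incl sch_q - b *\<^sub>C 1)"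
  have Du: "D * u \<in> J"
    using assms by (simp add: D_def distrib_right mult.assoc J_add J_mult)
  have lower: "filt (Suc n) u \<Longrightarrow> filt 1 u" for n
  proof (induction n)
    case (Suc n)
    have "filt (Suc n) (D * u + of_nat (Suc n) *\<^sub>C u)"
      using filt_euler[OF dual Suc.prems] unfolding D_def by (simp del: of_nat_Suc)
    then have "filt (Suc n) (of_nat (Suc n) *\<^sub>C u)"
      using filt_diff[OF _ filt.ideal[OF Du], of "Suc n"] by fastforce
    then have "filt (Suc n) (inverse (of_nat (Suc n)) *\<^sub>C (of_nat (Suc n) *\<^sub>C u))"
      by (rule filt.scale)
    then have "filt (Suc n) u"
      by (simp add: scaleC_scaleC scaleC_one del: of_nat_Suc)
    then show ?case by (rule Suc.IH)
  qed simp
  obtain n where "filt n u" using filt_exhausts by blast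
  then show ?thesis using lower filt_Suc filt_1 by blast
qed

end


section \<open>The annihilator of the cyclic vector\<close>

context left_module
begin

lemma act_zero_left: "x \<in> carrier M \<Longrightarrow> 0 \<odot> x = \<zero>"
  using act_add_left[of x 0 0] act_closed[of x 0] by simp

lemma act_zero_right: "u \<odot> \<zero> = \<zero>"
  using act_add_right[of \<zero> \<zero> u] act_closed[of \<zero> u] by simp

lemma act_diff_eq_zero_iff:
  assumes "x \<in> carrier M"
  shows "(u - v) \<odot> x = \<zero> \<longleftrightarrow> u \<odot> x = v \<odot> x"
proof -
  have "u \<odot> x = (u - v) \<odot> x \<oplus> v \<odot> x"
    using act_add_left[OF assms, of "u - v" v] by simp
  then show ?thesis
    using act_closed[OF assms] add.r_cancel_one[of "v \<odot> x" "(u - v) \<odot> x"] by auto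
qed

end

lemma induced_module_carrier: "carrier (induced_module j act)
    = range (\<lambda>x. tensor_relations j act +>\<^bsub>free_pairs\<^esub> x)"
  by (auto simp: quotient_module_def induced_module_def A_RCOSETS_def' free_pairs_def)

lemma induced_module_coset_eqI:
  assumes "x - y \<in> tensor_relations j act"
  shows "tensor_relations j act +>\<^bsub>free_pairs\<^esub> x = tensor_relations j act +>\<^bsub>free_pairs\<^esub> y"
proof -
  interpret N: abelian_subgroup "tensor_relations j act" free_pairs
    using additive_subgroup_tensor_relations abelian_group_free_pairs
    by (rule abelian_subgroupI3)
  have "x \<in> tensor_relations j act +>\<^bsub>free_pairs\<^esub> y"
    using assms by (force simp: a_r_coset_def' free_pairs_def)
  then show ?thesis
    using N.a_repr_independence'[of x y] by (simp add: free_pairs_def)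
qed

lemma induced_module_add:
  "(tensor_relations j act +>\<^bsub>free_pairs\<^esub> x) \<oplus>\<^bsub>induced_module j act\<^esub>
    (tensor_relations j act +>\<^bsub>free_pairs\<^esub> y) = tensor_relations j act +>\<^bsub>free_pairs\<^esub> (x + y)"
proof -
  interpret N: abelian_subgroup "tensor_relations j act" free_pairs
    using additive_subgroup_tensor_relations abelian_group_free_pairs
    by (rule abelian_subgroupI3)
  show ?thesis
    using N.a_rcos_sum[of x y] by (simp add: quotient_module_def induced_module_def free_pairs_def)
qed

lemma induced_act_pure: "u \<odot>\<^bsub>induced_module j act\<^esub> pure_tensor j act r n = pure_tensor j act (u * r) n"
  by (simp add: pure_tensor_def induced_act) (simp add: free_pairs_def)

lemma pure_tensor_balanced: "pure_tensor j act (r * j x) n = pure_tensor j act r (act x n)"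
  unfolding pure_tensor_def by (rule induced_module_coset_eqI) (rule tensor_relations.balanced)

text \<open>
  The scalar \<open>n\<close> is the image of \<open>1\<close> under the element \<open>n \<cdot> 1\<close> of the enveloping algebra of the
  Heisenberg algebra, and balancedness moves this element to the left factor.
\<close>

lemma M_mod_scalar:
  assumes "lie_algebra_hom \<phi>"
  shows "pure_tensor heis_incl (heis_char_act \<phi>) r n = (n *\<^sub>C r) \<odot>\<^bsub>M_mod \<phi>\<^esub> w_vec \<phi>"
proof -
  note lift = uea_lift_hom[OF uea_liftable_complex[OF assms]]
  note incl = uea_lift_hom[OF uea_liftable_map[OF lie_algebra_hom_Rep_heisenberg]]
  show ?thesis
    using pure_tensor_balanced[of heis_incl "heis_char_act \<phi>" r "n *\<^sub>C 1" 1]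
    by (simp add: w_vec_def M_mod_def induced_act_pure heis_char_act_def lift heis_incl_def
        uea_map_def incl mult_scaleC_right scaleC_complex_def)
qed

lemma M_mod_cyclic:
  assumes "lie_algebra_hom \<phi>" "x \<in> carrier (M_mod \<phi>)"
  shows "\<exists>u. x = u \<odot>\<^bsub>M_mod \<phi>\<^esub> w_vec \<phi>"
proof -
  interpret M: left_module "M_mod \<phi>" by (rule left_module_M_mod)
  let ?c = "\<lambda>y. tensor_relations heis_incl (heis_char_act \<phi>) +>\<^bsub>free_pairs\<^esub> y"
  have "\<exists>u. ?c y = u \<odot>\<^bsub>M_mod \<phi>\<^esub> w_vec \<phi>" for y
  proof -
    have "Poly_Mapping.keys y \<subseteq> UNIV" by simp
    then show ?thesis
    proof (induction y rule: frag_induction)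
      case zero
      have "?c 0 = 0 \<odot>\<^bsub>M_mod \<phi>\<^esub> ?c (frag_of (1, 1))"
        using induced_module_coset_eqI[of 0 "frag_of (0, 1)" heis_incl "heis_char_act \<phi>"]
          tensor_relations.add_left[of 0 0 1 heis_incl "heis_char_act \<phi>"]
        by (simp add: M_mod_def induced_act) (simp add: free_pairs_def)
      then show ?case by (auto simp: w_vec_def pure_tensor_def)
    next
      case (one x)
      then show ?case
        using M_mod_scalar[OF assms(1), of "fst x" "snd x"] by (auto simp: pure_tensor_def)
    next
      case (diff y z)
      then obtain u v where uv: "?c y = u \<odot>\<^bsub>M_mod \<phi>\<^esub> w_vec \<phi>" "?c z = v \<odot>\<^bsub>M_mod \<phi>\<^esub> w_vec \<phi>"
        by blast
      note closed = M.act_closed[OF w_vec_in_carrier]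
      have c: "?c (y - z) \<in> carrier (M_mod \<phi>)"
        by (auto simp: M_mod_def induced_module_carrier)
      have "?c (y - z) \<oplus>\<^bsub>M_mod \<phi>\<^esub> v \<odot>\<^bsub>M_mod \<phi>\<^esub> w_vec \<phi> = u \<odot>\<^bsub>M_mod \<phi>\<^esub> w_vec \<phi>"
        using induced_module_add[of heis_incl "heis_char_act \<phi>" "y - z" z] uv
        by (simp add: M_mod_def)
      also have "\<dots> = (u - v) \<odot>\<^bsub>M_mod \<phi>\<^esub> w_vec \<phi> \<oplus>\<^bsub>M_mod \<phi>\<^esub> v \<odot>\<^bsub>M_mod \<phi>\<^esub> w_vec \<phi>"
        using M.act_add_left[OF w_vec_in_carrier, of "u - v" v] by simp
      finally have "?c (y - z) \<oplus>\<^bsub>M_mod \<phi>\<^esub> v \<odot>\<^bsub>M_mod \<phi>\<^esub> w_vec \<phi>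
          = (u - v) \<odot>\<^bsub>M_mod \<phi>\<^esub> w_vec \<phi> \<oplus>\<^bsub>M_mod \<phi>\<^esub> v \<odot>\<^bsub>M_mod \<phi>\<^esub> w_vec \<phi>" .
      then show ?case
        using c closed by (auto simp: M.add.right_cancel)
    qed
  qed
  with assms(2) show ?thesis by (auto simp: M_mod_def induced_module_carrier)
qed

text \<open>Both sides equal \<open>1 \<otimes> \<phi> x\<close>, by moving \<open>x\<close> and the scalar \<open>\<phi> x\<close> through the tensor.\<close>

lemma w_vec_heis_act:
  assumes "lie_algebra_hom \<phi>"
  shows "uea_incl (Rep_heisenberg x) \<odot>\<^bsub>M_mod \<phi>\<^esub> w_vec \<phi> = (\<phi> x *\<^sub>C 1) \<odot>\<^bsub>M_mod \<phi>\<^esub> w_vec \<phi>"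
proof -
  note lift = uea_lift_hom[OF uea_liftable_complex[OF assms]]
  note incl = uea_lift_hom[OF uea_liftable_map[OF lie_algebra_hom_Rep_heisenberg]]
  have "uea_incl (Rep_heisenberg x) \<odot>\<^bsub>M_mod \<phi>\<^esub> w_vec \<phi>
      = pure_tensor heis_incl (heis_char_act \<phi>) 1 (\<phi> x)"
    using pure_tensor_balanced[of heis_incl "heis_char_act \<phi>" 1 "uea_incl x" 1]
    by (simp add: w_vec_def M_mod_def induced_act_pure heis_char_act_def lift heis_incl_def
        uea_map_def incl)
  also have "\<dots> = (\<phi> x *\<^sub>C 1) \<odot>\<^bsub>M_mod \<phi>\<^esub> w_vec \<phi>" by (rule M_mod_scalar[OF assms])
  finally show ?thesis .
qed

lemma L_mod_act:
  assumes "x \<in> carrier (M_mod \<phi>)"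
  shows "u \<odot>\<^bsub>L_mod \<phi> \<xi>\<^esub> L_proj \<phi> \<xi> x = L_proj \<phi> \<xi> (u \<odot>\<^bsub>M_mod \<phi>\<^esub> x)"
  unfolding L_mod_def L_proj_def
  by (rule left_module.quotient_act[OF left_module_M_mod submodule_of_W_sub assms])

lemma L_mod_carrier: "carrier (L_mod \<phi> \<xi>) = L_proj \<phi> \<xi> ` carrier (M_mod \<phi>)"
  by (auto simp: L_mod_def L_proj_def quotient_module_def A_RCOSETS_def')

lemma L_proj_W_sub: "x \<in> W_sub \<phi> \<xi> \<Longrightarrow> L_proj \<phi> \<xi> x = \<zero>\<^bsub>L_mod \<phi> \<xi>\<^esub>"
proof -
  assume x: "x \<in> W_sub \<phi> \<xi>"
  interpret M: left_module "M_mod \<phi>" by (rule left_module_M_mod)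
  interpret N: abelian_subgroup "W_sub \<phi> \<xi>" "M_mod \<phi>"
    using submodule_of_W_sub by (intro M.abelian_subgroupI4) (simp add: submodule_of_def)
  show ?thesis
    using x by (simp add: L_proj_def L_mod_def quotient_module_def N.a_rcos_const)
qed

lemma annihilator_whittaker_left_ideal:
  assumes hom: "lie_algebra_hom \<phi>" and nz: "\<phi> \<noteq> (\<lambda>_. 0)"
  shows "whittaker_left_ideal {u. u \<odot>\<^bsub>L_mod \<phi> \<xi>\<^esub> L_proj \<phi> \<xi> (w_vec \<phi>) = \<zero>\<^bsub>L_mod \<phi> \<xi>\<^esub>}
    (\<phi> heis_p) (\<phi> heis_q) \<xi>"
proof -
  interpret M: left_module "M_mod \<phi>" by (rule left_module_M_mod)
  interpret L: left_module "L_mod \<phi> \<xi>" by (rule left_module_L_mod)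
  let ?w = "L_proj \<phi> \<xi> (w_vec \<phi>)"
  have w: "?w \<in> carrier (L_mod \<phi> \<xi>)" by (simp add: L_mod_carrier w_vec_in_carrier)
  have heis: "(uea_incl (Rep_heisenberg x) - \<phi> x *\<^sub>C 1) \<odot>\<^bsub>L_mod \<phi> \<xi>\<^esub> ?w = \<zero>\<^bsub>L_mod \<phi> \<xi>\<^esub>" for x
    unfolding L.act_diff_eq_zero_iff[OF w]
    by (simp add: L_mod_act w_vec_in_carrier w_vec_heis_act[OF hom])
  have "heis_z = lie_bracket heis_p heis_q"
    by transfer (simp add: schroedinger_bracket_table)
  then have phi_z: "\<phi> heis_z = 0"
    using hom by (metis lie_algebra_hom_def lie_bracket_complex_def)
  have phi: "\<phi> x = cp (Rep_heisenberg x) * \<phi> heis_p + cq (Rep_heisenberg x) * \<phi> heis_q" for x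
  proof -
    have "x = cp (Rep_heisenberg x) *\<^sub>C heis_p + cq (Rep_heisenberg x) *\<^sub>C heis_q
        + cz (Rep_heisenberg x) *\<^sub>C heis_z"
      by transfer (unfold span_heisenberg_eq, simp add: schroedinger_defs schroedinger.expand)
    then have "\<phi> x = \<phi> (cp (Rep_heisenberg x) *\<^sub>C heis_p + cq (Rep_heisenberg x) *\<^sub>C heis_q
        + cz (Rep_heisenberg x) *\<^sub>C heis_z)" by simp
    then show ?thesis
      using hom phi_z by (simp add: lie_algebra_hom_def scaleC_complex_def)
  qed
  have C: "uea_incl (cas (\<phi> heis_p) (\<phi> heis_q)) = C_elem \<phi>"
    by (simp add: cas_def C_elem_def uea_incl_diff uea_incl_scaleC)
  have "(C_elem \<phi> - \<xi> *\<^sub>C 1) \<odot>\<^bsub>M_mod \<phi>\<^esub> w_vec \<phi> \<in> W_sub \<phi> \<xi>"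
    unfolding W_sub_def cyclic_submodule_def
    using M.act_one[OF M.act_closed[OF w_vec_in_carrier]] by (metis (mono_tags, lifting) mem_Collect_eq)
  then have cas: "(C_elem \<phi> - \<xi> *\<^sub>C 1) \<odot>\<^bsub>L_mod \<phi> \<xi>\<^esub> ?w = \<zero>\<^bsub>L_mod \<phi> \<xi>\<^esub>"
    by (simp add: L_mod_act w_vec_in_carrier L_proj_W_sub)
  show ?thesis
  proof
    show "\<phi> heis_p \<noteq> 0 \<or> \<phi> heis_q \<noteq> 0"
      using nz phi by (metis add_0 mult_zero_right)
  qed (use w heis[of heis_p] heis[of heis_q] heis[of heis_z] in
      \<open>auto simp: L.act_zero_left L.act_zero_right L.act_add_left L.act_mult
        heis_p.rep_eq heis_q.rep_eq heis_z.rep_eq phi_z C cas\<close>)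
qed

theorem proposition3p8:
  fixes \<phi> :: "heisenberg \<Rightarrow> complex" and \<xi> :: complex and w' :: "qw_elem set"
  assumes "lie_algebra_hom \<phi>"
    and "\<phi> \<noteq> (\<lambda>_. 0)"
    and "quasi_whittaker (L_mod \<phi> \<xi>) \<phi> w'"
  shows "\<exists>c :: complex. w' = (c *\<^sub>C 1) \<odot>\<^bsub>L_mod \<phi> \<xi>\<^esub> L_proj \<phi> \<xi> (w_vec \<phi>)"
proof -
  interpret L: left_module "L_mod \<phi> \<xi>" by (rule left_module_L_mod)
  let ?w = "L_proj \<phi> \<xi> (w_vec \<phi>)"
  interpret whittaker_left_ideal "{u. u \<odot>\<^bsub>L_mod \<phi> \<xi>\<^esub> ?w = \<zero>\<^bsub>L_mod \<phi> \<xi>\<^esub>}" "\<phi> heis_p" "\<phi> heis_q" \<xi>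
    using assms(1,2) by (rule annihilator_whittaker_left_ideal)
  have w: "?w \<in> carrier (L_mod \<phi> \<xi>)" by (simp add: L_mod_carrier w_vec_in_carrier)
  from assms(3) have w': "w' \<in> carrier (L_mod \<phi> \<xi>)"
    and heis: "\<And>x. uea_incl (Rep_heisenberg x) \<odot>\<^bsub>L_mod \<phi> \<xi>\<^esub> w' = (\<phi> x *\<^sub>C 1) \<odot>\<^bsub>L_mod \<phi> \<xi>\<^esub> w'"
    by (auto simp: quasi_whittaker_def)
  obtain u where u: "w' = u \<odot>\<^bsub>L_mod \<phi> \<xi>\<^esub> ?w"
    using w' M_mod_cyclic[OF assms(1)] by (auto simp: L_mod_carrier L_mod_act w_vec_in_carrier)
  have "(uea_incl (Rep_heisenberg x) - \<phi> x *\<^sub>C 1) \<odot>\<^bsub>L_mod \<phi> \<xi>\<^esub> w' = \<zero>\<^bsub>L_mod \<phi> \<xi>\<^esub>" for x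
    by (simp add: L.act_diff_eq_zero_iff[OF w'] heis)
  then have "((uea_incl (Rep_heisenberg x) - \<phi> x *\<^sub>C 1) * u) \<odot>\<^bsub>L_mod \<phi> \<xi>\<^esub> ?w = \<zero>\<^bsub>L_mod \<phi> \<xi>\<^esub>" for x
    by (simp add: L.act_mult[OF w] flip: u)
  from this[of heis_p] this[of heis_q] obtain c
    where "(u - c *\<^sub>C 1) \<odot>\<^bsub>L_mod \<phi> \<xi>\<^esub> ?w = \<zero>\<^bsub>L_mod \<phi> \<xi>\<^esub>"
    using whittaker_vector_scalar[of u] by (auto simp: heis_p.rep_eq heis_q.rep_eq)
  then show ?thesis
    by (auto simp: u L.act_diff_eq_zero_iff[OF w])
qed

end
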